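(* Let $s,r,N\in\mathbb{N}$. Then there exists $M=M(s,r,N)\in\mathbb{N}$ such that \[\frac{s}{r+i+sMj}\] is a $2$-step relation number for all integers $0\le i<N$ and all integers $j\ne 0$.
   Context: $\mathbb{N}$ is the set of positive integers. For $q\in\mathbb{C}$ let $a=\begin{pmatrix}1&0\\1&1\end{pmatrix}$ and $b_q=\begin{pmatrix}1&q\\0&1\end{pmatrix}$. For an integer $\ell\ge 0$, $q\in\mathbb{C}$ is an $\ell$-step relation number if there exist an integer $k$ with $0\le k\le \ell$ and nonzero integers $m_1,\dots,m_{2k+1}$ such that the matrix $b_q^{m_1}a^{m_2}b_q^{m_3}a^{m_4}\cdots a^{m_{2k}}b_q^{m_{2k+1}}$ is lower-triangular. *)

theory Defs
  imports "HOL-Analysis.Analysis"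
begin

(* Powers with respect to the matrix product; the overloaded A ^ n on complex^2^2 is entrywise. *)
definition mat_powi :: "complex^2^2 \<Rightarrow> int \<Rightarrow> complex^2^2" where
  "mat_powi A m =
     (if m \<ge> 0 then (((**) A) ^^ nat m) (mat 1)
      else (((**) (matrix_inv A)) ^^ nat (- m)) (mat 1))"

definition mat_a :: "complex^2^2" where
  "mat_a = vector [vector [1, 0], vector [1, 1]]"

definition mat_b :: "complex \<Rightarrow> complex^2^2" where
  "mat_b q = vector [vector [1, q], vector [0, 1]]"

(* In the index type 2 we have 2 = 0 < 1, so "i < j" would not describe the entries above
   the diagonal; the entry in row 1, column 2 is named explicitly. *)
definition lower_triangular :: "complex^2^2 \<Rightarrow> bool" where
  "lower_triangular A \<longleftrightarrow> A $ 1 $ 2 = 0"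

(* b_q^(m 1) a^(m 2) b_q^(m 3) ... a^(m (2k)) b_q^(m (2k+1)), multiplied in this order *)
definition relation_word :: "complex \<Rightarrow> nat \<Rightarrow> (nat \<Rightarrow> int) \<Rightarrow> complex^2^2" where
  "relation_word q k m =
     foldr (**) (map (\<lambda>i. mat_powi (if odd i then mat_b q else mat_a) (m i)) [1..<2*k+2]) (mat 1)"

definition step_relation_number :: "nat \<Rightarrow> complex \<Rightarrow> bool" where
  "step_relation_number l q \<longleftrightarrow>
     (\<exists>k\<le>l. \<exists>m :: nat \<Rightarrow> int.
        (\<forall>i\<in>{1..2*k+1}. m i \<noteq> 0) \<and> lower_triangular (relation_word q k m))"

end

theory Submission
  imports Defs
begin

text \<open>
  Put \<open>q = s / d\<close> with \<open>d = R + s R t\<close>. In the word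
  \<open>b\<^sup>R a\<^sup>-\<^sup>t b\<^sup>y a\<^sup>-\<^sup>t b\<^sup>R\<close> each outer block \<open>R, -t\<close> contributes to the upper right
  entry like a single exponent \<open>R d / (d - s t R) = d\<close> of \<open>b\<close>, so the entry vanishes for
  \<open>y = -2 d\<close>. Any \<open>M\<close> divisible by all \<open>R = r + i\<close> therefore works, once it is even, which
  keeps \<open>d = R (1 + s t)\<close> away from zero.
\<close>

text \<open>Keeps the entries visible, so that a word in the two generators is multiplied out by
  rewriting with \<open>mat2_mult\<close> alone.\<close>

definition mat2 :: "'a \<Rightarrow> 'a \<Rightarrow> 'a \<Rightarrow> 'a \<Rightarrow> 'a::zero^2^2" where
  "mat2 x y z w = vector [vector [x, y], vector [z, w]]"

lemma mat2_entry [simp]: "mat2 x y z w $ 1 $ 2 = y"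
  by (simp add: mat2_def)

lemma mat2_mult:
  fixes x :: "'a::semiring_1"
  shows "mat2 x y z w ** mat2 x' y' z' w' =
    mat2 (x * x' + y * z') (x * y' + y * w') (z * x' + w * z') (z * y' + w * w')"
  by (simp add: mat2_def matrix_matrix_mult_def vec_eq_iff sum_2 forall_2)

lemma mat_1_eq_mat2: "mat 1 = mat2 1 0 0 1"
  by (simp add: mat2_def mat_def vec_eq_iff forall_2)

text \<open>\<open>matrix_inv\<close> is a Hilbert choice; uniqueness of two-sided inverses pins
  down its value.\<close>

lemma matrix_inv_eqI:
  fixes A B :: "'a::semiring_1^'n^'n"
  assumes "A ** B = mat 1" "B ** A = mat 1"
  shows "matrix_inv A = B"
proof -
  have "matrix_inv A ** A = mat 1"
    unfolding matrix_inv_def by (rule someI2[of _ B]) (use assms in auto)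
  then show ?thesis
    using assms(1) by (metis matrix_mul_assoc matrix_mul_lid matrix_mul_rid)
qed

text \<open>A homomorphism from the additive integers sends \<open>- 1\<close> to the inverse of
  \<open>P 1\<close>, so it is the power map of \<open>P 1\<close>. Both unipotent generators lie on
  such a one-parameter family.\<close>

lemma mat_powi_additive:
  assumes hom: "\<And>m n. P (m + n) = P m ** P n" and zero: "P 0 = mat 1"
  shows "mat_powi (P 1) m = P m"
proof -
  have inv: "matrix_inv (P 1) = P (- 1)"
    using hom[of 1 "- 1"] hom[of "- 1" 1] zero by (intro matrix_inv_eqI) simp_all
  \<comment> \<open>Used with \<open>k = 1\<close> and \<open>k = - 1\<close>, one for each branch
    of \<open>mat_powi\<close>.\<close>
  have pow: "(((**) (P k)) ^^ n) (mat 1) = P (int n * k)" for k n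
    by (induction n) (simp_all add: zero hom algebra_simps)
  show ?thesis
    by (simp add: mat_powi_def inv pow)
qed

lemma mat_powi_b: "mat_powi (mat_b q) m = mat2 1 (of_int m * q) 0 1"
  using mat_powi_additive[of "\<lambda>m. mat2 1 (of_int m * q) 0 1" m]
  by (simp add: mat2_mult mat_1_eq_mat2 algebra_simps mat_b_def flip: mat2_def)

lemma mat_powi_a: "mat_powi mat_a m = mat2 1 0 (of_int m) 1"
  using mat_powi_additive[of "\<lambda>m. mat2 1 0 (of_int m) 1" m]
  by (simp add: mat2_mult mat_1_eq_mat2 algebra_simps mat_a_def flip: mat2_def)

lemma relation_word_2_entry:
  "relation_word q 2 m $ 1 $ 2 =
    q * (of_int (m 1 + m 3 + m 5)
      + q * of_int (m 4 * m 5 * (m 1 + m 3) + m 1 * m 2 * (m 3 + m 5))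
      + q^2 * of_int (m 1 * m 2 * m 3 * m 4 * m 5))"
proof -
  have "[1..<2 * 2 + 2] = [1, 2, 3, 4, 5::nat]"
    by (simp add: upt_rec)
  then show ?thesis
    by (simp add: relation_word_def mat_powi_a mat_powi_b mat_1_eq_mat2 mat2_mult
        algebra_simps power2_eq_square)
qed

lemma step_relation_number_2:
  fixes R s t d :: int
  assumes d: "d = R + s * R * t" and nz: "R \<noteq> 0" "t \<noteq> 0" "d \<noteq> 0"
  shows "step_relation_number 2 (of_int s / of_int d)"
proof -
  define q :: complex where "q = of_int s / of_int d"
  define m :: "nat \<Rightarrow> int" where
    "m = (\<lambda>i. if i = 3 then - 2 * d else if odd i then R else - t)"
  have m: "m 1 = R" "m 2 = - t" "m 3 = - 2 * d" "m 4 = - t" "m 5 = R"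
    by (simp_all add: m_def)
  have qd: "q * of_int d = of_int s"
    using nz by (simp add: q_def)
  have sRt: "of_int s * of_int R * of_int t = (of_int d - of_int R :: complex)"
    by (simp add: d)
  have "of_int d * (q * of_int R * of_int t) = (of_int d - of_int R :: complex)"
    unfolding sRt[symmetric] qd[symmetric] by (simp add: mult_ac)
  \<comment> \<open>With \<open>u = q * R * t\<close> the left side is
    \<open>- 2 * (1 - u) * (d * (1 - u) - R)\<close>, and the last factor vanishes because
    \<open>d * u = d - R\<close>.\<close>
  then have "of_int (m 1 + m 3 + m 5)
      + q * of_int (m 4 * m 5 * (m 1 + m 3) + m 1 * m 2 * (m 3 + m 5))
      + q^2 * of_int (m 1 * m 2 * m 3 * m 4 * m 5) = 0"
    unfolding m of_int_mult of_int_add of_int_minus of_int_numeral by algebra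
  then have "lower_triangular (relation_word q 2 m)"
    unfolding lower_triangular_def relation_word_2_entry by simp
  moreover have "\<forall>i\<in>{1..2 * 2 + 1}. m i \<noteq> 0"
    using nz by (auto simp: m_def)
  ultimately show ?thesis
    unfolding step_relation_number_def q_def by blast
qed

theorem theorem1p7:
  fixes s r N :: nat
  assumes "s > 0" and "r > 0" and "N > 0"
  shows "\<exists>M::nat. M > 0 \<and>
    (\<forall>i j :: int. 0 \<le> i \<and> i < int N \<and> j \<noteq> 0 \<longrightarrow>
       int r + i + int s * int M * j \<noteq> 0 \<and>
       step_relation_number 2
         (of_nat s / of_int (int r + i + int s * int M * j)))"
proof -
  define M where "M = 2 * (\<Prod>k<N. r + k)"
  have "M > 0"
    using assms by (auto simp: M_def intro!: prod_pos)
  moreover have "int r + i + int s * int M * j \<noteq> 0 \<and>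
      step_relation_number 2 (of_nat s / of_int (int r + i + int s * int M * j))"
    if "0 \<le> i" "i < int N" "j \<noteq> 0" for i j :: int
  proof -
    define R where "R = int r + i"
    define d where "d = R + int s * int M * j"
    have "r + nat i dvd (\<Prod>k<N. r + k)"
      using that by (intro dvd_prodI) auto
    then obtain c where c: "(\<Prod>k<N. r + k) = (r + nat i) * c" ..
    have M: "int M = R * (2 * int c)"
      using that by (simp add: M_def c R_def)
    \<comment> \<open>This exhibits \<open>t = 2 * c * j\<close>, which is nonzero once
      \<open>c\<close> is, since \<open>j\<close> is nonzero.\<close>
    have d_eq: "d = R + int s * R * (2 * int c * j)"
      by (simp add: d_def M)
    have "R \<noteq> 0"
      using assms that by (simp add: R_def)
    moreover have "c \<noteq> 0"
      using M \<open>M > 0\<close> by (cases "c = 0") auto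
    moreover have "d \<noteq> 0"
    proof -
      have "d = R * (1 + 2 * (int s * int c * j))"
        by (simp add: d_eq algebra_simps)
      \<comment> \<open>An odd integer is nonzero: the purpose of the factor 2 in
        \<open>M\<close>.\<close>
      moreover have "1 + 2 * (int s * int c * j) \<noteq> 0"
        by presburger
      ultimately show ?thesis
        using \<open>R \<noteq> 0\<close> by simp
    qed
    ultimately show ?thesis
      using step_relation_number_2[OF d_eq] that by (simp add: d_def R_def)
  qed
  ultimately show ?thesis
    by blast
qed

end
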